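(* Let $(S_1,X_1)$ be a random vector with $S_1\ge 0$ real valued, $\mathbb{P}[S_1=0]<1$, and $X_1$ taking values in $\mathbb{R}^d$, $d\ge 1$, and assume that the limit $\ell:=\lim_{s\uparrow+\infty}-\frac{1}{s}\ln\mathbb{P}[S_1>s]$ exists in $[0,+\infty]$. With $\varphi$ and $I$ defined as in the context, the following hold: (i) the function $\varphi$ is upper semicontinuous and concave on $\mathbb{R}^d$; (ii) $I(w)=\sup_{k\in\mathbb{R}^d}\{w\cdot k+\varphi(k)\wedge\ell\}$ for all $w\in\mathbb{R}^d$.
   Context: All random variables live on a probability space $(\Omega,\mathcal{F},\mathbb{P})$ with expectation $\mathbb{E}$. Any dependence between $S_1$ (waiting time) and $X_1$ (reward) is allowed. Conventions: $\ln 0=-\infty$, $\ln(+\infty)=+\infty$, $a\wedge b:=\min\{a,b\}$, the supremum of the empty set is $-\infty$; functions take extended real values. For $k\in\mathbb{R}^d$ set $$\varphi(k):=\sup\Big\{\zeta\in\mathbb{R}:\ \mathbb{E}\big[e^{\zeta S_1+k\cdot X_1}\big]\le 1\Big\}.$$ For $(s,w)\in\mathbb{R}\times\mathbb{R}^d$ set $$J(s,w):=\sup_{(\zeta,k)\in\mathbb{R}\times\mathbb{R}^d}\Big\{s\zeta+w\cdot k-\ln\mathbb{E}\big[e^{\zeta S_1+k\cdot X_1}\big]\Big\}.$$ For $(\beta,w)\in\mathbb{R}\times\mathbb{R}^d$ set $$\Upsilon(\beta,w):=\lim_{\delta\downarrow 0}\ \inf_{s\in(\beta-\delta,\beta+\delta)}\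 \inf_{v\in\Delta_{w,\delta}}\ \inf_{\gamma>0}\Big\{\gamma J\Big(\frac{s}{\gamma},\frac{v}{\gamma}\Big)\Big\},$$ where $\Delta_{w,\delta}:=\{v\in\mathbb{R}^d:\|v-w\|<\delta\}$ is the open Euclidean ball. For $w\in\mathbb{R}^d$ set $$I(w):=\begin{cases}\inf_{\beta\in[0,1]}\{\Upsilon(\beta,w)+(1-\beta)\ell\} & \text{if }\ell<+\infty,\\ \Upsilon(1,w) & \text{if }\ell=+\infty.\end{cases}$$ *)

theory Defs
  imports "HOL-Probability.Probability"
begin

definition ln_ennreal :: "ennreal \<Rightarrow> ereal" where
  "ln_ennreal x =
     (if x = 0 then -\<infinity> else if x = \<infinity> then \<infinity> else ereal (ln (enn2real x)))"

definition upper_semicontinuous :: "('b::topological_space \<Rightarrow> ereal) \<Rightarrow> bool" where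
  "upper_semicontinuous f \<longleftrightarrow> (\<forall>x. Limsup (at x) f \<le> f x)"

(* Only points where f > -\<infinity> are tested: the inequality is vacuous at the others, while
   ereal addition would evaluate -\<infinity> + \<infinity> to \<infinity>. *)
definition ereal_concave :: "('b::real_vector \<Rightarrow> ereal) \<Rightarrow> bool" where
  "ereal_concave f \<longleftrightarrow>
     (\<forall>x y t. 0 < t \<and> t < 1 \<and> f x \<noteq> -\<infinity> \<and> f y \<noteq> -\<infinity> \<longrightarrow>
        ereal (1 - t) * f x + ereal t * f y \<le> f ((1 - t) *\<^sub>R x + t *\<^sub>R y))"

(* E[exp(\<zeta> S + k . X)], with value \<infinity> allowed *)
definition exp_moment ::
    "'a measure \<Rightarrow> ('a \<Rightarrow> real) \<Rightarrow> ('a \<Rightarrow> real ^ 'n) \<Rightarrow> real \<Rightarrow> real ^ 'n \<Rightarrow> ennreal" where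
  "exp_moment M S X \<zeta> k = (\<integral>\<^sup>+ \<omega>. ennreal (exp (\<zeta> * S \<omega> + k \<bullet> X \<omega>)) \<partial>M)"

definition phi ::
    "'a measure \<Rightarrow> ('a \<Rightarrow> real) \<Rightarrow> ('a \<Rightarrow> real ^ 'n) \<Rightarrow> real ^ 'n \<Rightarrow> ereal" where
  "phi M S X k = Sup {ereal \<zeta> |\<zeta>. exp_moment M S X \<zeta> k \<le> 1}"

definition cramer_J ::
    "'a measure \<Rightarrow> ('a \<Rightarrow> real) \<Rightarrow> ('a \<Rightarrow> real ^ 'n) \<Rightarrow> real \<Rightarrow> real ^ 'n \<Rightarrow> ereal" where
  "cramer_J M S X s w =
     (SUP (\<zeta>, k) \<in> UNIV. ereal (s * \<zeta> + w \<bullet> k) - ln_ennreal (exp_moment M S X \<zeta> k))"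

(* The infimum grows as \<delta> decreases, so the limit exists in ereal and Lim denotes it. *)
definition Upsilon ::
    "'a measure \<Rightarrow> ('a \<Rightarrow> real) \<Rightarrow> ('a \<Rightarrow> real ^ 'n) \<Rightarrow> real \<Rightarrow> real ^ 'n \<Rightarrow> ereal" where
  "Upsilon M S X \<beta> w =
     Lim (at_right 0) (\<lambda>\<delta>. INF s \<in> {\<beta> - \<delta><..<\<beta> + \<delta>}. INF v \<in> ball w \<delta>. INF \<gamma> \<in> {0<..}.
       ereal \<gamma> * cramer_J M S X (s / \<gamma>) (v /\<^sub>R \<gamma>))"

definition rate_I ::
    "'a measure \<Rightarrow> ('a \<Rightarrow> real) \<Rightarrow> ('a \<Rightarrow> real ^ 'n) \<Rightarrow> ereal \<Rightarrow> real ^ 'n \<Rightarrow> ereal" where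
  "rate_I M S X l w =
     (if l < \<infinity> then INF \<beta> \<in> {0..1}. Upsilon M S X \<beta> w + ereal (1 - \<beta>) * l
      else Upsilon M S X 1 w)"

end

theory Submission
  imports Defs
begin

text \<open>
Everything is read off from one closed convex set,
\<open>C = {(\<zeta>, k). E[exp (\<zeta> S + k \<bullet> X)] \<le> 1}\<close>. It is closed by Fatou's lemma and convex because the
exponential is. As \<open>S \<ge> 0\<close>, every fibre \<open>{\<zeta>. (\<zeta>, k) \<in> C}\<close> is a lower set, and it is bounded above
because \<open>S\<close> is not almost surely zero; so \<open>C\<close> is the hypograph of \<open>\<phi>\<close> (\<open>le_phi_iff\<close>), and \<open>\<phi>\<close> is
upper semicontinuous and concave.

The variational formula rests on the identity
\<open>\<Upsilon>(\<beta>, w) = sup {\<beta> \<zeta> + w \<bullet> k | (\<zeta>, k) \<in> C}\<close> (\<open>Upsilon_eq_support\<close>): \<open>\<Upsilon>\<close> is the support function of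
\<open>C\<close>. Indeed, let \<open>\<Lambda>\<close> be the logarithm of the exponential moment and \<open>J\<close> its convex conjugate. The
positively homogeneous function \<open>G(y) = inf {\<gamma> J(y / \<gamma>) | \<gamma> > 0}\<close> has conjugate
\<open>sup {\<gamma> \<Lambda>(p) | \<gamma> > 0}\<close>, which is \<open>0\<close> if \<open>\<Lambda>(p) \<le> 0\<close> and \<open>\<infinity>\<close> otherwise, that is, the convex indicator
function of \<open>C\<close>; and \<open>\<Upsilon>\<close> is the lower semicontinuous envelope of \<open>G\<close>, hence the conjugate of that
indicator function. The conjugate of \<open>J\<close> being \<open>\<Lambda>\<close> is the Fenchel-Moreau theorem, which appears
as \<open>epigraph_affine_separation\<close>; the second duality, for \<open>G\<close>, is
\<open>support_bound_in_closure_perspective_epigraph\<close>. Both work with epigraphs in place of extended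
real functions: the epigraph of \<open>\<Lambda>\<close> is itself an exponential sublevel set, since
\<open>\<Lambda>(p) \<le> r\<close> says that \<open>exp (p \<bullet> (S, X) - r)\<close> has expectation at most \<open>1\<close>, so that it is closed and
convex for the same reason as \<open>C\<close>.

For \<open>\<ell> = \<infinity>\<close> the formula is the identity at \<open>\<beta> = 1\<close>. For finite \<open>\<ell>\<close> the rate function is
\<open>inf {sup {w \<bullet> k + \<beta> \<zeta> + (1 - \<beta>) \<ell> | (\<zeta>, k) \<in> C} | \<beta> \<in> [0, 1]}\<close>. The expression is affine in \<open>\<beta>\<close> and in
\<open>(\<zeta>, k)\<close>, so infimum and supremum may be exchanged (\<open>convex_plane_minimax\<close>), and the inner infimum
over \<open>\<beta>\<close> then is \<open>w \<bullet> k + min \<zeta> \<ell>\<close>.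
\<close>

section \<open>Exponential sublevel sets\<close>

definition exp_sublevel :: "'a measure \<Rightarrow> ('a \<Rightarrow> 'b::euclidean_space) \<Rightarrow> 'b set" where
  "exp_sublevel M Z = {z. (\<integral>\<^sup>+ \<omega>. ennreal (exp (z \<bullet> Z \<omega>)) \<partial>M) \<le> 1}"

lemma convex_exp_sublevel:
  assumes [measurable]: "Z \<in> borel_measurable M"
  shows "convex (exp_sublevel M Z)"
proof (rule convexI)
  fix x y u v
  assume x: "x \<in> exp_sublevel M Z" and y: "y \<in> exp_sublevel M Z"
    and uv: "0 \<le> u" "0 \<le> v" "u + v = (1::real)"
  let ?e = "\<lambda>z \<omega>. ennreal (exp (z \<bullet> Z \<omega>))"
  have pt: "?e (u *\<^sub>R x + v *\<^sub>R y) \<omega> \<le> ennreal u * ?e x \<omega> + ennreal v * ?e y \<omega>" for \<omega>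
  proof -
    have "convex_on UNIV (exp :: real \<Rightarrow> real)"
      by (rule exp_convex)
    then have "exp (u *\<^sub>R (x \<bullet> Z \<omega>) + v *\<^sub>R (y \<bullet> Z \<omega>))
        \<le> u * exp (x \<bullet> Z \<omega>) + v * exp (y \<bullet> Z \<omega>)"
      using uv unfolding convex_on_def by blast
    then show ?thesis
      using uv by (simp add: inner_add_left ennreal_mult[symmetric] ennreal_plus[symmetric]
          del: ennreal_plus)
  qed
  have "(\<integral>\<^sup>+ \<omega>. ?e (u *\<^sub>R x + v *\<^sub>R y) \<omega> \<partial>M)
      \<le> (\<integral>\<^sup>+ \<omega>. ennreal u * ?e x \<omega> + ennreal v * ?e y \<omega> \<partial>M)"
    by (intro nn_integral_mono pt)
  also have "\<dots> = ennreal u * (\<integral>\<^sup>+ \<omega>. ?e x \<omega> \<partial>M) + ennreal v * (\<integral>\<^sup>+ \<omega>. ?e y \<omega> \<partial>M)"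
    by (simp add: nn_integral_add nn_integral_cmult)
  also have "\<dots> \<le> ennreal u * 1 + ennreal v * 1"
    using x y unfolding exp_sublevel_def by (intro add_mono mult_left_mono) auto
  also have "\<dots> = 1"
    using uv by (simp add: ennreal_plus[symmetric] del: ennreal_plus)
  finally show "u *\<^sub>R x + v *\<^sub>R y \<in> exp_sublevel M Z"
    unfolding exp_sublevel_def by simp
qed

lemma closed_exp_sublevel:
  assumes [measurable]: "Z \<in> borel_measurable M"
  shows "closed (exp_sublevel M Z)"
  unfolding closed_sequential_limits
proof (intro allI impI, elim conjE)
  fix z l assume z: "\<forall>n. z n \<in> exp_sublevel M Z" and lim: "z \<longlonglongrightarrow> l"
  let ?e = "\<lambda>z \<omega>. ennreal (exp (z \<bullet> Z \<omega>))"
  have "liminf (\<lambda>n. ?e (z n) \<omega>) = ?e l \<omega>" for \<omega>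
    by (intro lim_imp_Liminf tendsto_ennrealI tendsto_exp tendsto_inner lim tendsto_const) simp
  then have "(\<integral>\<^sup>+ \<omega>. ?e l \<omega> \<partial>M) = (\<integral>\<^sup>+ \<omega>. liminf (\<lambda>n. ?e (z n) \<omega>) \<partial>M)"
    by simp
  also have "\<dots> \<le> liminf (\<lambda>n. \<integral>\<^sup>+ \<omega>. ?e (z n) \<omega> \<partial>M)"
    by (intro nn_integral_liminf) measurable
  also have "\<dots> \<le> 1"
    using z by (intro Liminf_le always_eventually) (auto simp: exp_sublevel_def)
  finally show "l \<in> exp_sublevel M Z"
    unfolding exp_sublevel_def by simp
qed

section \<open>Convex duality\<close>

text \<open>
Strict inequalities survive small perturbations. The two duality proofs use this to tilt a
vertical separating hyperplane into a non-vertical one.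
\<close>

lemma small_positive_multiplier:
  fixes A B :: real
  assumes "0 < B"
  obtains \<eta> where "0 < \<eta>" "\<eta> * A < B"
proof
  show "0 < B / (2 * (\<bar>A\<bar> + 1))" using assms by simp
  have "A / (2 * (\<bar>A\<bar> + 1)) < 1" by (simp add: divide_simps) linarith
  then have "B * (A / (2 * (\<bar>A\<bar> + 1))) < B * 1"
    by (rule mult_strict_left_mono[OF _ assms])
  then show "B / (2 * (\<bar>A\<bar> + 1)) * A < B" by simp
qed

text \<open>
The Fenchel-Moreau theorem in terms of the epigraph \<open>P\<close>: a point below the graph lies below some
affine minorant \<open>p' \<mapsto> x \<bullet> p' - b\<close>. A hyperplane separating the point from \<open>P\<close> may be vertical. The
point below \<open>(p0, r0)\<close> ensures that there is also a non-vertical one, and a small multiple of the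
latter added to the former gives a non-vertical hyperplane that still separates.
\<close>

lemma epigraph_affine_separation:
  fixes P :: "('v::euclidean_space \<times> real) set"
  assumes "closed P" "convex P"
    and up: "\<forall>p r s. (p, r) \<in> P \<longrightarrow> r \<le> s \<longrightarrow> (p, s) \<in> P"
    and p0: "(p0, r0) \<in> P" "(p0, r1) \<notin> P"
    and p: "(p, m) \<notin> P"
  shows "\<exists>x b. (\<forall>p' r. (p', r) \<in> P \<longrightarrow> x \<bullet> p' - r \<le> b) \<and> b < x \<bullet> p - m"
proof -
  have sep: "\<exists>x q c. 0 \<le> q \<and> x \<bullet> y + q * s < c \<and> (\<forall>p' r. (p', r) \<in> P \<longrightarrow> c < x \<bullet> p' + q * r)"
    if "(y, s) \<notin> P" for y s
  proof -
    obtain a c where ac: "a \<bullet> (y, s) < c" "\<forall>z\<in>P. c < a \<bullet> z"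
      using separating_hyperplane_closed_point[OF assms(2,1) \<open>(y, s) \<notin> P\<close>] by blast
    obtain x q where a: "a = (x, q)" by (cases a)
    have ineq: "c < x \<bullet> p' + q * r" if "(p', r) \<in> P" for p' r
      using ac(2) that by (force simp: a)
    have "0 \<le> q"
    proof (rule ccontr)
      assume q: "\<not> 0 \<le> q"
      \<comment> \<open>Going up from \<open>(p0, r0)\<close> far enough would cross the hyperplane.\<close>
      define t where "t = max r0 ((c - x \<bullet> p0) / q)"
      have "c < x \<bullet> p0 + q * t"
        by (intro ineq up[rule_format, OF p0(1)]) (simp add: t_def)
      moreover have "q * t \<le> q * ((c - x \<bullet> p0) / q)"
        using q by (intro mult_left_mono_neg) (auto simp: t_def)
      ultimately show False using q by simp
    qed
    then show ?thesis using ac(1) ineq by (auto simp: a)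
  qed
  obtain x1 q1 c1 where 1: "0 \<le> q1" "x1 \<bullet> p0 + q1 * r1 < c1"
      "\<And>p' r. (p', r) \<in> P \<Longrightarrow> c1 < x1 \<bullet> p' + q1 * r"
    using sep[OF p0(2)] by blast
  \<comment> \<open>Both points lie over \<open>p0\<close>, and no vertical hyperplane separates them.\<close>
  have "q1 \<noteq> 0"
    using 1(2) 1(3)[OF p0(1)] by auto
  then have q1: "0 < q1" using 1(1) by simp
  define x0 b0 where "x0 = (- 1 / q1) *\<^sub>R x1" and "b0 = - c1 / q1"
  have minorant: "x0 \<bullet> p' - r \<le> b0" if "(p', r) \<in> P" for p' r
  proof -
    have "- (x1 \<bullet> p') - q1 * r \<le> - c1" using 1(3)[OF that] by simp
    then have "(- (x1 \<bullet> p') - q1 * r) / q1 \<le> - c1 / q1" using q1 by (intro divide_right_mono) auto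
    then show ?thesis using q1 by (simp add: x0_def b0_def diff_divide_distrib)
  qed
  obtain x q c where 2: "0 \<le> q" "x \<bullet> p + q * m < c"
      "\<And>p' r. (p', r) \<in> P \<Longrightarrow> c < x \<bullet> p' + q * r"
    using sep[OF p] by blast
  obtain \<eta> where \<eta>: "0 < \<eta>" "\<eta> * (m - x0 \<bullet> p + b0) < c - (x \<bullet> p + q * m)"
    using small_positive_multiplier[of "c - (x \<bullet> p + q * m)"] 2(2) by auto
  define Q where "Q = q + \<eta>"
  have Q: "0 < Q" using 2(1) \<eta>(1) by (simp add: Q_def)
  show ?thesis
  proof (intro exI conjI allI impI)
    fix p' r assume P: "(p', r) \<in> P"
    have "\<eta> * (x0 \<bullet> p' - r) \<le> \<eta> * b0"
      using minorant[OF P] \<eta>(1) by simp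
    with 2(3)[OF P] have "\<eta> * (x0 \<bullet> p') - x \<bullet> p' - Q * r \<le> \<eta> * b0 - c"
      by (simp add: Q_def algebra_simps)
    then have "(\<eta> * (x0 \<bullet> p') - x \<bullet> p' - Q * r) / Q \<le> (\<eta> * b0 - c) / Q"
      using Q by (intro divide_right_mono) auto
    then show "((1 / Q) *\<^sub>R (\<eta> *\<^sub>R x0 - x)) \<bullet> p' - r \<le> (\<eta> * b0 - c) / Q"
      using Q by (simp add: inner_diff_left diff_divide_distrib)
  next
    have "\<eta> * b0 - c < \<eta> * (x0 \<bullet> p) - x \<bullet> p - Q * m"
      using \<eta>(2) by (simp add: Q_def algebra_simps)
    then have "(\<eta> * b0 - c) / Q < (\<eta> * (x0 \<bullet> p) - x \<bullet> p - Q * m) / Q"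
      using Q by (intro divide_strict_right_mono) auto
    then show "(\<eta> * b0 - c) / Q < ((1 / Q) *\<^sub>R (\<eta> *\<^sub>R x0 - x)) \<bullet> p - m"
      using Q by (simp add: inner_diff_left diff_divide_distrib)
  qed
qed

text \<open>
If \<open>P\<close> is the epigraph of \<open>\<Lambda>\<close> with conjugate \<open>J\<close>, the condition for a given \<open>\<gamma>\<close> says that
\<open>\<gamma> J(x / \<gamma>) \<le> a\<close>. In this form it is linear in \<open>(x, \<gamma>, a)\<close>, so that the union over \<open>\<gamma>\<close> visibly is a
convex cone.
\<close>

definition perspective_epigraph :: "('v::euclidean_space \<times> real) set \<Rightarrow> ('v \<times> real) set" where
  "perspective_epigraph P = {(x, a). \<exists>\<gamma>>0. \<forall>(p, r)\<in>P. x \<bullet> p - \<gamma> * r \<le> a}"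

lemma perspective_epigraph_add:
  assumes "z \<in> perspective_epigraph P" "z' \<in> perspective_epigraph P"
  shows "z + z' \<in> perspective_epigraph P"
proof -
  obtain x a \<gamma> where 1: "z = (x, a)" "0 < \<gamma>" "\<And>p r. (p, r) \<in> P \<Longrightarrow> x \<bullet> p - \<gamma> * r \<le> a"
    using assms(1) unfolding perspective_epigraph_def by force
  obtain x' a' \<gamma>' where 2: "z' = (x', a')" "0 < \<gamma>'"
      "\<And>p r. (p, r) \<in> P \<Longrightarrow> x' \<bullet> p - \<gamma>' * r \<le> a'"
    using assms(2) unfolding perspective_epigraph_def by force
  have "(x + x') \<bullet> p - (\<gamma> + \<gamma>') * r \<le> a + a'" if "(p, r) \<in> P" for p r
    using 1(3)[OF that] 2(3)[OF that] by (simp add: inner_add_left distrib_right)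
  then show ?thesis
    using 1(1,2) 2(1,2) unfolding perspective_epigraph_def
    by (auto intro!: exI[of _ "\<gamma> + \<gamma>'"])
qed

lemma perspective_epigraph_scaleR:
  assumes "z \<in> perspective_epigraph P" "0 < t"
  shows "t *\<^sub>R z \<in> perspective_epigraph P"
proof -
  obtain x a \<gamma> where 1: "z = (x, a)" "0 < \<gamma>" "\<And>p r. (p, r) \<in> P \<Longrightarrow> x \<bullet> p - \<gamma> * r \<le> a"
    using assms(1) unfolding perspective_epigraph_def by force
  have "(t *\<^sub>R x) \<bullet> p - (t * \<gamma>) * r \<le> t * a" if "(p, r) \<in> P" for p r
    using mult_left_mono[OF 1(3)[OF that], of t] assms(2) by (simp add: algebra_simps)
  then show ?thesis
    using 1(1,2) assms(2) unfolding perspective_epigraph_def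
    by (auto intro!: exI[of _ "t * \<gamma>"])
qed

lemma convex_perspective_epigraph: "convex (perspective_epigraph P)"
proof (rule convexI)
  fix z z' :: "'a \<times> real" and u v :: real
  assume z: "z \<in> perspective_epigraph P" "z' \<in> perspective_epigraph P"
    and uv: "0 \<le> u" "0 \<le> v" "u + v = 1"
  consider "u = 0" "v = 1" | "u = 1" "v = 0" | "0 < u" "0 < v"
    using uv by linarith
  then show "u *\<^sub>R z + v *\<^sub>R z' \<in> perspective_epigraph P"
    using z by cases (simp_all add: perspective_epigraph_add perspective_epigraph_scaleR)
qed

text \<open>
If \<open>a\<close> bounds \<open>y \<bullet> p\<close> on the zero sublevel set, then \<open>\<gamma> J(x / \<gamma>)\<close> comes below \<open>a + \<epsilon>\<close> for points \<open>x\<close>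
arbitrarily close to \<open>y\<close>. Otherwise a hyperplane separates \<open>(y, a)\<close> from the cone; after tilting
it reads \<open>b \<ge> x \<bullet> p\<close> on the cone and \<open>a < y \<bullet> p\<close>. The first inequality says that \<open>J(x) \<ge> x \<bullet> p\<close> for
all \<open>x\<close>, which by Fenchel-Moreau puts \<open>p\<close> in the zero sublevel set, against the choice of \<open>a\<close>.
\<close>

lemma support_bound_in_closure_perspective_epigraph:
  fixes P :: "('v::euclidean_space \<times> real) set"
  assumes "closed P" "convex P"
    and up: "\<forall>p r s. (p, r) \<in> P \<longrightarrow> r \<le> s \<longrightarrow> (p, s) \<in> P"
    and zero: "(0, 0) \<in> P" and neg: "(0, - 1) \<notin> P"
    and bound: "\<And>p. (p, 0) \<in> P \<Longrightarrow> y \<bullet> p \<le> a"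
  shows "(y, a) \<in> closure (perspective_epigraph P)"
proof (rule ccontr)
  let ?E = "perspective_epigraph P"
  assume "(y, a) \<notin> closure ?E"
  then obtain d c where d: "d \<bullet> (y, a) < c" "\<forall>z\<in>closure ?E. c < d \<bullet> z"
    using separating_hyperplane_closed_point[of "closure ?E"]
      convex_closure[OF convex_perspective_epigraph] by blast
  obtain u q where uq: "d = (u, q)" by (cases d)
  have gt: "c < u \<bullet> x + q * r" if "(x, r) \<in> ?E" for x r
    using d(2) closure_subset that by (force simp: uq)
  have nonneg: "0 \<le> r" if "(x, r) \<in> ?E" for x r
    using that zero unfolding perspective_epigraph_def by force
  obtain x0 b0 where x0: "\<And>p r. (p, r) \<in> P \<Longrightarrow> x0 \<bullet> p - r \<le> b0"
    using epigraph_affine_separation[OF assms(1,2) up zero neg neg] by metis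
  then have x0E: "(x0, b) \<in> ?E" if "b0 \<le> b" for b
    using that unfolding perspective_epigraph_def by (fastforce intro!: exI[of _ "1::real"])
  \<comment> \<open>On a cone, a linear functional that is bounded below is nonnegative, and the bound is not
    positive.\<close>
  have cone: "0 \<le> u \<bullet> x + q * r" if "(x, r) \<in> ?E" for x r
  proof (rule ccontr)
    assume neg: "\<not> 0 \<le> u \<bullet> x + q * r"
    define t where "t = (\<bar>c\<bar> + 1) / - (u \<bullet> x + q * r)"
    have t: "0 < t" using neg unfolding t_def by (intro divide_pos_pos) auto
    have "c < u \<bullet> (t *\<^sub>R x) + q * (t * r)"
      using perspective_epigraph_scaleR[OF that t] by (intro gt) simp
    also have "\<dots> = t * (u \<bullet> x + q * r)" by (simp add: algebra_simps)
    also have "\<dots> = - (\<bar>c\<bar> + 1)" using neg unfolding t_def by (simp only: divide_minus_right) simp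
    finally show False by simp
  qed
  have "c \<le> 0"
  proof (rule ccontr)
    assume "\<not> c \<le> 0"
    then obtain t where t: "0 < t" "t * (u \<bullet> x0 + q * b0) < c"
      using small_positive_multiplier[of c] by auto
    have "c < u \<bullet> (t *\<^sub>R x0) + q * (t * b0)"
      using perspective_epigraph_scaleR[OF x0E[OF order_refl] t(1)] by (intro gt) simp
    then show False using t(2) by (simp add: algebra_simps)
  qed
  have "0 \<le> q"
  proof (rule ccontr)
    assume q: "\<not> 0 \<le> q"
    define b where "b = max b0 ((c - u \<bullet> x0) / q)"
    have "c < u \<bullet> x0 + q * b"
      by (intro gt x0E) (simp add: b_def)
    moreover have "q * b \<le> q * ((c - u \<bullet> x0) / q)"
      using q by (intro mult_left_mono_neg) (auto simp: b_def)
    ultimately show False using q by simp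
  qed
  have "u \<bullet> y + q * a < 0"
    using d(1) \<open>c \<le> 0\<close> by (simp add: uq)
  then obtain \<eta> where \<eta>: "0 < \<eta>" "\<eta> * a < - (u \<bullet> y + q * a)"
    using small_positive_multiplier[of "- (u \<bullet> y + q * a)" a] by auto
  \<comment> \<open>Raising \<open>q\<close> keeps the functional nonnegative on the cone, where the last coordinate is
    nonnegative, and makes the hyperplane non-vertical.\<close>
  define Q where "Q = q + \<eta>"
  have Q: "0 < Q" using \<open>0 \<le> q\<close> \<eta>(1) by (simp add: Q_def)
  define p where "p = (- 1 / Q) *\<^sub>R u"
  have below: "x \<bullet> p \<le> b" if "(x, b) \<in> ?E" for x b
  proof -
    have "0 \<le> (u \<bullet> x + q * b) + \<eta> * b"
      using nonneg[OF that] \<eta>(1) by (intro add_nonneg_nonneg[OF cone[OF that]]) auto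
    then have "0 \<le> u \<bullet> x + Q * b"
      by (simp add: Q_def distrib_right)
    then show ?thesis using Q by (simp add: p_def field_simps inner_commute)
  qed
  have "(p, 0) \<in> P"
  proof (rule ccontr)
    assume "(p, 0) \<notin> P"
    then obtain x b where xb: "\<And>p' r. (p', r) \<in> P \<Longrightarrow> x \<bullet> p' - r \<le> b" "b < x \<bullet> p - 0"
      using epigraph_affine_separation[OF assms(1,2) up zero neg] by metis
    have "(x, b) \<in> ?E"
      using xb(1) unfolding perspective_epigraph_def by (auto intro!: exI[of _ "1::real"])
    then show False using below xb(2) by force
  qed
  then have "y \<bullet> p \<le> a" by (rule bound)
  then have "0 \<le> u \<bullet> y + Q * a"
    using Q by (simp add: p_def field_simps inner_commute)
  then show False using \<eta>(2) by (simp add: Q_def algebra_simps)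
qed

text \<open>
The minimax theorem for an affine family \<open>(1 - t) f + t g\<close> on a convex set, where \<open>V\<close> is the joint
range of \<open>f\<close> and \<open>g\<close>. By hypothesis \<open>V\<close> misses the open quadrant above \<open>(m, m)\<close>. A line separating
the two has a normal vector with nonnegative coordinates, which becomes \<open>(1 - t, t)\<close> when
normalised.
\<close>

lemma convex_plane_minimax:
  fixes V :: "(real \<times> real) set"
  assumes V: "convex V" "V \<noteq> {}" and m: "\<And>a b. (a, b) \<in> V \<Longrightarrow> min a b \<le> m"
  shows "\<exists>t\<in>{0..1}. \<forall>a b. (a, b) \<in> V \<longrightarrow> (1 - t) * a + t * b \<le> m"
proof -
  let ?T = "{m<..} \<times> {m<..}"
  have "\<exists>d c. d \<noteq> 0 \<and> (\<forall>z\<in>V. d \<bullet> z \<le> c) \<and> (\<forall>z\<in>?T. c \<le> d \<bullet> z)"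
  proof (rule separating_hyperplane_sets)
    show "convex ?T" by (intro convex_Times) auto
    show "?T \<noteq> {}" using gt_ex[of m] by auto
    show "V \<inter> ?T = {}" using m by force
  qed (use V in auto)
  then obtain d c where "d \<noteq> 0" and dV: "\<And>z. z \<in> V \<Longrightarrow> d \<bullet> z \<le> c"
    and dT: "\<And>z. z \<in> ?T \<Longrightarrow> c \<le> d \<bullet> z" by blast
  obtain u v where d: "d = (u, v)" by (cases d)
  have T: "c \<le> (u + v) * m + u * s + v * t" if "0 < s" "0 < t" for s t
    using dT[of "(m + s, m + t)"] that by (simp add: d algebra_simps)
  have coeff: "0 \<le> x" if *: "\<And>s. 0 < s \<Longrightarrow> e \<le> x * s" for x e :: real
  proof (rule ccontr)
    assume "\<not> 0 \<le> x"
    then have "e \<le> x * ((\<bar>e\<bar> + 1) / - x)" by (intro * divide_pos_pos) auto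
    also have "\<dots> = - (\<bar>e\<bar> + 1)" using \<open>\<not> 0 \<le> x\<close> by (simp add: field_simps)
    finally show False by simp
  qed
  have u: "0 \<le> u" by (rule coeff[of "c - (u + v) * m - v"]) (use T[of _ 1] in force)
  have v: "0 \<le> v" by (rule coeff[of "c - (u + v) * m - u"]) (use T[of 1] in force)
  have uv: "0 < u + v" using u v \<open>d \<noteq> 0\<close> by (auto simp: d zero_prod_def)
  have c: "c \<le> (u + v) * m"
  proof (rule field_le_epsilon)
    fix e :: real assume "0 < e"
    then have "c \<le> (u + v) * m + (u + v) * (e / (u + v))"
      using T[of "e / (u + v)" "e / (u + v)"] uv by (simp add: distrib_right add_divide_distrib)
    then show "c \<le> (u + v) * m + e"
      using uv by simp
  qed
  show ?thesis
  proof (intro bexI allI impI)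
    show "v / (u + v) \<in> {0..1}" using u v uv by auto
    fix a b assume "(a, b) \<in> V"
    then have "u * a + v * b \<le> (u + v) * m" using dV[of "(a, b)"] c by (simp add: d)
    then have "(u * a + v * b) / (u + v) \<le> m" using uv by (simp add: divide_le_eq mult.commute)
    moreover have "1 - v / (u + v) = u / (u + v)" using uv by (simp add: field_simps)
    ultimately show "(1 - v / (u + v)) * a + v / (u + v) * b \<le> m"
      by (simp add: add_divide_distrib)
  qed
qed

section \<open>The hypograph of \<open>\<phi>\<close>\<close>

abbreviation moment_set :: "'a measure \<Rightarrow> ('a \<Rightarrow> real) \<Rightarrow> ('a \<Rightarrow> real ^ 'n) \<Rightarrow> (real \<times> (real ^ 'n)) set"
  where "moment_set M S X \<equiv> exp_sublevel M (\<lambda>\<omega>. (S \<omega>, X \<omega>))"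

abbreviation cumulant_epigraph ::
    "'a measure \<Rightarrow> ('a \<Rightarrow> real) \<Rightarrow> ('a \<Rightarrow> real ^ 'n) \<Rightarrow> ((real \<times> (real ^ 'n)) \<times> real) set"
  where "cumulant_epigraph M S X \<equiv> exp_sublevel M (\<lambda>\<omega>. ((S \<omega>, X \<omega>), - 1))"

lemma mem_moment_set: "(\<zeta>, k) \<in> moment_set M S X \<longleftrightarrow> exp_moment M S X \<zeta> k \<le> 1"
  by (simp add: exp_sublevel_def exp_moment_def)

locale reward_process = prob_space M for M :: "'a measure" +
  fixes S :: "'a \<Rightarrow> real" and X :: "'a \<Rightarrow> real ^ 'n"
  assumes measurable_S [measurable]: "S \<in> borel_measurable M"
    and measurable_X [measurable]: "X \<in> borel_measurable M"
    and S_nonneg: "\<And>\<omega>. \<omega> \<in> space M \<Longrightarrow> 0 \<le> S \<omega>"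
    and S_zero: "prob {\<omega> \<in> space M. S \<omega> = 0} < 1"
begin

lemma measurable_SX [measurable]: "(\<lambda>\<omega>. (S \<omega>, X \<omega>)) \<in> borel_measurable M"
  by (intro borel_measurable_Pair) measurable

lemma measurable_SX_minus_one [measurable]: "(\<lambda>\<omega>. ((S \<omega>, X \<omega>), - 1 :: real)) \<in> borel_measurable M"
  by (intro borel_measurable_Pair) measurable

lemma zero_mem_moment_set: "(0, 0) \<in> moment_set M S X"
  by (simp add: mem_moment_set exp_moment_def emeasure_space_1)

text \<open>
Appending the constant coordinate \<open>- 1\<close> multiplies the exponential by \<open>exp (- r)\<close>, which turns
the bound \<open>1\<close> into the bound \<open>exp r\<close>.
\<close>

lemma mem_cumulant_epigraph:
  "((\<zeta>, k), r) \<in> cumulant_epigraph M S X \<longleftrightarrow> exp_moment M S X \<zeta> k \<le> ennreal (exp r)"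
proof -
  have "exp_moment M S X \<zeta> k
      = (\<integral>\<^sup>+ \<omega>. ennreal (exp r) * ennreal (exp ((\<zeta> * S \<omega> + k \<bullet> X \<omega>) - r)) \<partial>M)"
    unfolding exp_moment_def by (simp add: ennreal_mult[symmetric] mult_exp_exp)
  also have "\<dots> = ennreal (exp r) * (\<integral>\<^sup>+ \<omega>. ennreal (exp ((\<zeta> * S \<omega> + k \<bullet> X \<omega>) - r)) \<partial>M)"
    by (rule nn_integral_cmult) measurable
  finally have *: "exp_moment M S X \<zeta> k
      = ennreal (exp r) * (\<integral>\<^sup>+ \<omega>. ennreal (exp ((\<zeta> * S \<omega> + k \<bullet> X \<omega>) - r)) \<partial>M)" .
  have "ennreal (exp r) * x \<le> ennreal (exp r) \<longleftrightarrow> x \<le> 1" for x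
    using ennreal_mult_le_mult_iff[of "ennreal (exp r)" x 1] by simp
  then show ?thesis
    by (simp add: exp_sublevel_def *)
qed

lemma exp_moment_mono:
  assumes "\<zeta> \<le> \<zeta>'"
  shows "exp_moment M S X \<zeta> k \<le> exp_moment M S X \<zeta>' k"
  unfolding exp_moment_def
  using assms by (intro nn_integral_mono ennreal_leI) (auto intro: mult_right_mono S_nonneg)

lemma exp_moment_pos: "exp_moment M S X \<zeta> k \<noteq> 0"
proof
  assume "exp_moment M S X \<zeta> k = 0"
  then have "AE \<omega> in M. ennreal (exp (\<zeta> * S \<omega> + k \<bullet> X \<omega>)) = 0"
    unfolding exp_moment_def by (subst (asm) nn_integral_0_iff_AE) measurable
  then have "AE \<omega> in M. False" by simp
  then show False by simp
qed

text \<open>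
If all moments were at most \<open>1\<close>, then \<open>n S \<le> exp (n S)\<close> would give
\<open>n E[S exp (k \<bullet> X)] \<le> 1\<close> for every \<open>n\<close>, hence \<open>S = 0\<close> almost surely.
\<close>

lemma exp_moment_unbounded: "\<exists>\<zeta>. 1 < exp_moment M S X \<zeta> k"
proof (rule ccontr)
  assume "\<not> ?thesis"
  then have le: "exp_moment M S X \<zeta> k \<le> 1" for \<zeta> by (simp add: not_less)
  let ?I = "\<integral>\<^sup>+ \<omega>. ennreal (S \<omega> * exp (k \<bullet> X \<omega>)) \<partial>M"
  have bound: "of_nat n * ?I \<le> 1" for n :: nat
  proof -
    have "of_nat n * ?I = (\<integral>\<^sup>+ \<omega>. of_nat n * ennreal (S \<omega> * exp (k \<bullet> X \<omega>)) \<partial>M)"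
      by (rule nn_integral_cmult[symmetric]) measurable
    also have "\<dots> \<le> exp_moment M S X (real n) k"
      unfolding exp_moment_def
    proof (rule nn_integral_mono)
      fix \<omega> assume "\<omega> \<in> space M"
      then have S: "0 \<le> S \<omega>" by (rule S_nonneg)
      have "real n * S \<omega> \<le> exp (real n * S \<omega>)"
        using exp_ge_add_one_self[of "real n * S \<omega>"] by linarith
      then have "real n * S \<omega> * exp (k \<bullet> X \<omega>) \<le> exp (real n * S \<omega>) * exp (k \<bullet> X \<omega>)"
        by (intro mult_right_mono) auto
      then show "of_nat n * ennreal (S \<omega> * exp (k \<bullet> X \<omega>))
          \<le> ennreal (exp (real n * S \<omega> + k \<bullet> X \<omega>))"
        using S by (simp add: ennreal_of_nat_eq_real_of_nat ennreal_mult[symmetric] exp_add mult.assoc)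
    qed
    also have "\<dots> \<le> 1" by (rule le)
    finally show ?thesis .
  qed
  have "?I = 0"
  proof (rule ccontr)
    assume "?I \<noteq> 0"
    moreover have "?I \<noteq> \<infinity>" using bound[of 1] by (auto simp: top_unique)
    ultimately obtain r where r: "?I = ennreal r" "0 < r"
      by (cases ?I) (auto simp: less_le)
    obtain n :: nat where "1 / r < real n" using reals_Archimedean2 by blast
    then have "1 < real n * r" using r(2) by (simp add: field_simps)
    moreover have "real n * r \<le> 1"
      using bound[of n] r by (simp add: ennreal_of_nat_eq_real_of_nat ennreal_mult[symmetric])
    ultimately show False by simp
  qed
  then have "AE \<omega> in M. ennreal (S \<omega> * exp (k \<bullet> X \<omega>)) = 0"
    by (subst (asm) nn_integral_0_iff_AE) measurable
  then have "AE \<omega> in M. S \<omega> = 0"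
  proof (rule AE_mp, intro AE_I2 impI)
    fix \<omega> assume "\<omega> \<in> space M" "ennreal (S \<omega> * exp (k \<bullet> X \<omega>)) = 0"
    then show "S \<omega> = 0"
      using S_nonneg[of \<omega>] by (simp add: ennreal_eq_0_iff mult_le_0_iff)
  qed
  then have "prob {\<omega> \<in> space M. S \<omega> = 0} = 1"
    by (subst prob_Collect_eq_1) measurable
  then show False using S_zero by simp
qed

text \<open>
The supremum defining \<open>\<phi>\<close> is attained when it is not \<open>-\<infinity>\<close>: monotonicity in \<open>\<zeta>\<close> puts everything
strictly below \<open>\<phi>(k)\<close> into the set, and closedness adds the end point.
\<close>

lemma le_phi_iff: "ereal \<zeta> \<le> phi M S X k \<longleftrightarrow> (\<zeta>, k) \<in> moment_set M S X"
proof
  assume "(\<zeta>, k) \<in> moment_set M S X"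
  then show "ereal \<zeta> \<le> phi M S X k"
    unfolding phi_def mem_moment_set by (intro Sup_upper) auto
next
  assume le: "ereal \<zeta> \<le> phi M S X k"
  have "(\<zeta> - 1 / real (Suc n), k) \<in> moment_set M S X" for n
  proof -
    have "ereal (\<zeta> - 1 / real (Suc n)) < ereal \<zeta>" by simp
    also note le
    finally obtain \<zeta>' where "\<zeta> - 1 / real (Suc n) < \<zeta>'" "exp_moment M S X \<zeta>' k \<le> 1"
      unfolding phi_def less_Sup_iff by auto
    then show ?thesis
      unfolding mem_moment_set using exp_moment_mono[of "\<zeta> - 1 / real (Suc n)" \<zeta>' k] by force
  qed
  moreover have "(\<lambda>n. (\<zeta> - 1 / real (Suc n), k)) \<longlonglongrightarrow> (\<zeta> - 0, k)"
    by (intro tendsto_Pair tendsto_diff tendsto_const LIMSEQ_Suc[OF lim_1_over_n])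
  ultimately show "(\<zeta>, k) \<in> moment_set M S X"
    using closed_sequentially[OF closed_exp_sublevel[OF measurable_SX]] by force
qed

lemma phi_finite: "phi M S X k \<noteq> \<infinity>"
proof -
  obtain \<zeta> where "1 < exp_moment M S X \<zeta> k" using exp_moment_unbounded by blast
  then show ?thesis using le_phi_iff[of \<zeta> k] by (auto simp: mem_moment_set)
qed

text \<open>
If \<open>\<phi>(x) < b\<close> then \<open>(b, x)\<close> lies in the open complement of the hypograph, and so does \<open>(b, y)\<close> for
\<open>y\<close> near \<open>x\<close>.
\<close>

lemma upper_semicontinuous_phi: "upper_semicontinuous (phi M S X)"
  unfolding upper_semicontinuous_def
proof
  fix x
  show "Limsup (at x) (phi M S X) \<le> phi M S X x"
  proof (rule ereal_le_real)
    fix a assume "phi M S X x \<le> ereal a"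
    show "Limsup (at x) (phi M S X) \<le> ereal a"
    proof (rule ereal_le_epsilon2)
      fix e :: real assume "0 < e"
      define b where "b = a + e"
      have "phi M S X x < ereal b"
        using \<open>phi M S X x \<le> ereal a\<close> \<open>0 < e\<close> by (simp add: b_def le_less_trans)
      then have "x \<in> (\<lambda>y. (b, y)) -` (- moment_set M S X)"
        by (simp add: le_phi_iff[symmetric])
      moreover have "open ((\<lambda>y. (b, y)) -` (- moment_set M S X))"
        by (intro open_vimage[OF open_Compl[OF closed_exp_sublevel[OF measurable_SX]]] continuous_intros)
      ultimately have "\<forall>\<^sub>F y in nhds x. y \<in> (\<lambda>y. (b, y)) -` (- moment_set M S X)"
        by (intro eventually_nhds_in_open)
      then have "\<forall>\<^sub>F y in at x. (b, y) \<notin> moment_set M S X"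
        unfolding eventually_at_filter by eventually_elim simp
      then have "\<forall>\<^sub>F y in at x. phi M S X y \<le> ereal b"
        by eventually_elim (simp add: le_phi_iff[symmetric])
      then show "Limsup (at x) (phi M S X) \<le> ereal a + ereal e"
        unfolding b_def by (simp add: Limsup_bounded)
    qed
  qed
qed

lemma ereal_concave_phi: "ereal_concave (phi M S X)"
  unfolding ereal_concave_def
proof (intro allI impI, elim conjE)
  fix x y :: "real ^ 'n" and t :: real
  assume t: "0 < t" "t < 1" and fin: "phi M S X x \<noteq> -\<infinity>" "phi M S X y \<noteq> -\<infinity>"
  obtain a b where ab: "phi M S X x = ereal a" "phi M S X y = ereal b"
    using fin phi_finite by (metis ereal_cases)
  then have "(a, x) \<in> moment_set M S X" "(b, y) \<in> moment_set M S X"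
    by (simp_all add: le_phi_iff[symmetric])
  then have "(1 - t) *\<^sub>R (a, x) + t *\<^sub>R (b, y) \<in> moment_set M S X"
    using t by (intro convexD convex_exp_sublevel) auto
  then show "ereal (1 - t) * phi M S X x + ereal t * phi M S X y
      \<le> phi M S X ((1 - t) *\<^sub>R x + t *\<^sub>R y)"
    by (simp add: ab le_phi_iff)
qed

section \<open>The function \<open>\<Upsilon>\<close> as a support function\<close>

text \<open>
This replaces the extended real logarithm by the epigraph: points where the exponential moment is
infinite contribute \<open>-\<infinity>\<close> to the supremum and have no point of the epigraph above them.
\<close>

lemma cramer_J_le_iff:
  "cramer_J M S X s v \<le> ereal a
    \<longleftrightarrow> (\<forall>(p, r)\<in>cumulant_epigraph M S X. (s, v) \<bullet> p - r \<le> a)"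
proof -
  have term_le: "ereal (s * \<zeta> + v \<bullet> k) - ln_ennreal (exp_moment M S X \<zeta> k) \<le> ereal a
      \<longleftrightarrow> (\<forall>r. ((\<zeta>, k), r) \<in> cumulant_epigraph M S X \<longrightarrow> (s, v) \<bullet> (\<zeta>, k) - r \<le> a)" for \<zeta> k
  proof (cases "exp_moment M S X \<zeta> k")
    case (real m)
    then have m: "0 < m" using exp_moment_pos[of \<zeta> k] by (auto simp: less_le)
    have "((\<zeta>, k), r) \<in> cumulant_epigraph M S X \<longleftrightarrow> ln m \<le> r" for r
      using m exp_le_cancel_iff[of "ln m" r] by (simp add: mem_cumulant_epigraph real(2) ennreal_le_iff)
    moreover have "ln_ennreal (exp_moment M S X \<zeta> k) = ereal (ln m)"
      using m by (simp add: ln_ennreal_def real(2))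
    ultimately show ?thesis by (auto intro: order_trans[OF diff_left_mono])
  next
    case top
    then show ?thesis by (auto simp: mem_cumulant_epigraph ln_ennreal_def top_unique)
  qed
  show ?thesis
    unfolding cramer_J_def SUP_le_iff using term_le by (simp add: split_paired_Ball_Sigma split_paired_All Ball_def)
qed

lemma perspective_J_le_iff:
  assumes "0 < \<gamma>"
  shows "ereal \<gamma> * cramer_J M S X (s / \<gamma>) (v /\<^sub>R \<gamma>) \<le> ereal a
    \<longleftrightarrow> (\<forall>(p, r)\<in>cumulant_epigraph M S X. (s, v) \<bullet> p - \<gamma> * r \<le> a)"
proof -
  have "ereal \<gamma> * y \<le> ereal a \<longleftrightarrow> y \<le> ereal (a / \<gamma>)" for y
    using assms by (cases y) (auto simp: field_simps)
  moreover have "(s / \<gamma>, v /\<^sub>R \<gamma>) \<bullet> p - r \<le> a / \<gamma> \<longleftrightarrow> (s, v) \<bullet> p - \<gamma> * r \<le> a" for p r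
  proof -
    have "(s / \<gamma>, v /\<^sub>R \<gamma>) \<bullet> p - r = ((s, v) \<bullet> p - \<gamma> * r) / \<gamma>"
      using assms by (cases p) (simp add: field_simps)
    then show ?thesis using assms by (simp add: divide_le_cancel)
  qed
  ultimately show ?thesis by (simp add: cramer_J_le_iff)
qed

text \<open>
Points of the moment set have nonpositive cumulant, so that \<open>\<gamma> J(y / \<gamma>) \<ge> y \<bullet> p - \<gamma> \<Lambda>(p) \<ge> y \<bullet> p\<close>.
\<close>

lemma support_le_perspective_J:
  assumes "p \<in> moment_set M S X" "0 < \<gamma>"
  shows "ereal ((s, v) \<bullet> p) \<le> ereal \<gamma> * cramer_J M S X (s / \<gamma>) (v /\<^sub>R \<gamma>)"
proof (rule ereal_le_real)
  fix a assume "ereal \<gamma> * cramer_J M S X (s / \<gamma>) (v /\<^sub>R \<gamma>) \<le> ereal a"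
  moreover have "(p, 0) \<in> cumulant_epigraph M S X"
    using assms(1) by (cases p) (simp add: mem_moment_set mem_cumulant_epigraph)
  ultimately show "ereal ((s, v) \<bullet> p) \<le> ereal a"
    using assms(2) by (force simp: perspective_J_le_iff)
qed

text \<open>
The function \<open>F\<close> whose limit defines \<open>\<Upsilon>\<close> is squeezed: duality bounds it above by the support
function \<open>\<sigma>\<close> for every \<open>\<delta>\<close>, and each point \<open>p\<close> of the moment set bounds it below by the linear
functional of \<open>p\<close>, up to an error proportional to \<open>\<delta>\<close>.
\<close>

lemma Upsilon_eq_support:
  "Upsilon M S X \<beta> w = (SUP p\<in>moment_set M S X. ereal ((\<beta>, w) \<bullet> p))" (is "_ = ?\<sigma>")
proof -
  define F where "F = (\<lambda>\<delta>. INF s \<in> {\<beta> - \<delta><..<\<beta> + \<delta>}. INF v \<in> ball w \<delta>. INF \<gamma> \<in> {0<..}.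
       ereal \<gamma> * cramer_J M S X (s / \<gamma>) (v /\<^sub>R \<gamma>))"
  have upper: "F \<delta> \<le> ?\<sigma>" if "0 < \<delta>" for \<delta>
  proof (rule ereal_le_real)
    fix a assume a: "?\<sigma> \<le> ereal a"
    have "((\<beta>, w), a) \<in> closure (perspective_epigraph (cumulant_epigraph M S X))"
    proof (rule support_bound_in_closure_perspective_epigraph)
      show "closed (cumulant_epigraph M S X)" "convex (cumulant_epigraph M S X)"
        by (intro closed_exp_sublevel convex_exp_sublevel measurable_SX_minus_one)+
      show "\<forall>p r r'. (p, r) \<in> cumulant_epigraph M S X \<longrightarrow> r \<le> r' \<longrightarrow> (p, r') \<in> cumulant_epigraph M S X"
        by (auto simp: mem_cumulant_epigraph elim!: order_trans intro!: ennreal_leI)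
      show "(0, 0) \<in> cumulant_epigraph M S X" "(0, - 1) \<notin> cumulant_epigraph M S X"
        by (simp_all add: zero_prod_def mem_cumulant_epigraph exp_moment_def emeasure_space_1)
      show "(\<beta>, w) \<bullet> p \<le> a" if "(p, 0) \<in> cumulant_epigraph M S X" for p
      proof -
        have "p \<in> moment_set M S X"
          using that by (cases p) (simp add: mem_moment_set mem_cumulant_epigraph)
        then have "ereal ((\<beta>, w) \<bullet> p) \<le> ereal a" using a by (simp add: SUP_le_iff)
        then show ?thesis by simp
      qed
    qed
    note closure = this
    show "F \<delta> \<le> ereal a"
    proof (rule ereal_le_epsilon2)
      fix e :: real assume "0 < e"
      have "0 < min \<delta> e" using \<open>0 < \<delta>\<close> \<open>0 < e\<close> by simp
      then obtain z where "z \<in> perspective_epigraph (cumulant_epigraph M S X)"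
          "dist z ((\<beta>, w), a) < min \<delta> e"
        using closure unfolding closure_approachable by blast
      moreover obtain s v b where "z = ((s, v), b)" by (metis prod.exhaust)
      ultimately have sv: "((s, v), b) \<in> perspective_epigraph (cumulant_epigraph M S X)"
        and d: "dist ((s, v), b) ((\<beta>, w), a) < min \<delta> e" by simp_all
      have "dist s \<beta> < \<delta>" "dist v w < \<delta>" "dist b a < e"
        using d dist_fst_le[of "((s, v), b)" "((\<beta>, w), a)"] dist_snd_le[of "((s, v), b)" "((\<beta>, w), a)"]
          dist_fst_le[of "(s, v)" "(\<beta>, w)"] dist_snd_le[of "(s, v)" "(\<beta>, w)"] by auto
      then have mem: "s \<in> {\<beta> - \<delta><..<\<beta> + \<delta>}" "v \<in> ball w \<delta>" and b: "b \<le> a + e"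
        by (auto simp: dist_real_def dist_commute)
      obtain \<gamma> where \<gamma>: "0 < \<gamma>" "ereal \<gamma> * cramer_J M S X (s / \<gamma>) (v /\<^sub>R \<gamma>) \<le> ereal b"
        using sv perspective_J_le_iff unfolding perspective_epigraph_def by blast
      have "F \<delta> \<le> ereal \<gamma> * cramer_J M S X (s / \<gamma>) (v /\<^sub>R \<gamma>)"
        unfolding F_def using mem \<gamma>(1) by (intro INF_lower2[OF mem(1)] INF_lower2[OF mem(2)] INF_lower) auto
      also have "\<dots> \<le> ereal a + ereal e"
        using \<gamma>(2) b by (simp add: order_trans)
      finally show "F \<delta> \<le> ereal a + ereal e" .
    qed
  qed
  have lower: "ereal ((\<beta>, w) \<bullet> p - \<delta> * (\<bar>fst p\<bar> + norm (snd p))) \<le> F \<delta>"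
    if p: "p \<in> moment_set M S X" for \<delta> p
    unfolding F_def
  proof (intro INF_greatest)
    fix s v \<gamma> assume s: "s \<in> {\<beta> - \<delta><..<\<beta> + \<delta>}" and v: "v \<in> ball w \<delta>" and \<gamma>: "\<gamma> \<in> {0::real<..}"
    obtain \<zeta> k where pk: "p = (\<zeta>, k)" by (cases p)
    have "(\<beta> - s) * \<zeta> \<le> \<delta> * \<bar>\<zeta>\<bar>"
    proof -
      have "(\<beta> - s) * \<zeta> \<le> \<bar>\<beta> - s\<bar> * \<bar>\<zeta>\<bar>" by (metis abs_ge_self abs_mult)
      also have "\<dots> \<le> \<delta> * \<bar>\<zeta>\<bar>" using s by (intro mult_right_mono) auto
      finally show ?thesis .
    qed
    moreover have "(w - v) \<bullet> k \<le> \<delta> * norm k"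
    proof -
      have "(w - v) \<bullet> k \<le> norm (w - v) * norm k" by (rule norm_cauchy_schwarz)
      also have "\<dots> \<le> \<delta> * norm k" using v by (intro mult_right_mono) (auto simp: dist_norm)
      finally show ?thesis .
    qed
    ultimately have "ereal ((\<beta>, w) \<bullet> p - \<delta> * (\<bar>fst p\<bar> + norm (snd p))) \<le> ereal ((s, v) \<bullet> p)"
      by (simp add: pk algebra_simps)
    also have "\<dots> \<le> ereal \<gamma> * cramer_J M S X (s / \<gamma>) (v /\<^sub>R \<gamma>)"
      using support_le_perspective_J[OF p] \<gamma> by simp
    finally show "ereal ((\<beta>, w) \<bullet> p - \<delta> * (\<bar>fst p\<bar> + norm (snd p)))
        \<le> ereal \<gamma> * cramer_J M S X (s / \<gamma>) (v /\<^sub>R \<gamma>)" .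
  qed
  have "(F \<longlongrightarrow> ?\<sigma>) (at_right 0)"
  proof (rule order_tendstoI)
    fix a assume "?\<sigma> < a"
    then show "\<forall>\<^sub>F \<delta> in at_right 0. F \<delta> < a"
      using upper by (intro eventually_at_right_less[THEN eventually_mono]) (auto intro: le_less_trans)
  next
    fix a assume "a < ?\<sigma>"
    then obtain p where p: "p \<in> moment_set M S X" "a < ereal ((\<beta>, w) \<bullet> p)"
      by (auto simp: less_SUP_iff)
    have "((\<lambda>\<delta>. ereal ((\<beta>, w) \<bullet> p - \<delta> * (\<bar>fst p\<bar> + norm (snd p))))
        \<longlongrightarrow> ereal ((\<beta>, w) \<bullet> p - 0 * (\<bar>fst p\<bar> + norm (snd p)))) (at_right 0)"
      by (intro tendsto_intros)
    then have "\<forall>\<^sub>F \<delta> in at_right 0. a < ereal ((\<beta>, w) \<bullet> p - \<delta> * (\<bar>fst p\<bar> + norm (snd p)))"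
      using p(2) by (intro order_tendstoD(1)) auto
    then show "\<forall>\<^sub>F \<delta> in at_right 0. a < F \<delta>"
      by eventually_elim (rule less_le_trans[OF _ lower[OF p(1)]])
  qed
  then show ?thesis
    unfolding Upsilon_def F_def by (intro tendsto_Lim) auto
qed

section \<open>The variational formula\<close>

text \<open>
Since \<open>\<phi>(k)\<close> is attained, taking the supremum over its hypograph gives the same value; arguments
with \<open>\<phi>(k) = -\<infinity>\<close> contribute nothing to either side.
\<close>

lemma SUP_phi_eq:
  "(SUP k. ereal (w \<bullet> k) + min (phi M S X k) l)
    = (SUP (\<zeta>, k)\<in>moment_set M S X. ereal (w \<bullet> k) + min (ereal \<zeta>) l)" (is "?L = ?R")
proof (rule antisym)
  show "?L \<le> ?R"
  proof (rule SUP_least)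
    fix k
    show "ereal (w \<bullet> k) + min (phi M S X k) l \<le> ?R"
    proof (cases "phi M S X k")
      case (real z)
      then have "(z, k) \<in> moment_set M S X" by (simp add: le_phi_iff[symmetric])
      then show ?thesis unfolding real by (rule SUP_upper2) simp
    qed (simp_all add: phi_finite)
  qed
  show "?R \<le> ?L"
  proof (rule SUP_least, clarify)
    fix \<zeta> k assume "(\<zeta>, k) \<in> moment_set M S X"
    then have "ereal (w \<bullet> k) + min (ereal \<zeta>) l \<le> ereal (w \<bullet> k) + min (phi M S X k) l"
      by (intro add_left_mono min.mono) (simp_all add: le_phi_iff)
    also have "\<dots> \<le> ?L" by (rule SUP_upper) simp
    finally show "ereal (w \<bullet> k) + min (ereal \<zeta>) l \<le> ?L" .
  qed
qed

lemma INF_Upsilon_eq: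
  "(INF \<beta>\<in>{0..1}. Upsilon M S X \<beta> w + ereal (1 - \<beta>) * ereal c)
    = (SUP (\<zeta>, k)\<in>moment_set M S X. ereal (w \<bullet> k + min \<zeta> c))" (is "?L = ?R")
proof (rule antisym)
  let ?C = "moment_set M S X"
  show "?R \<le> ?L"
  proof (intro INF_greatest SUP_least, clarify)
    fix \<beta> \<zeta> k assume \<beta>: "\<beta> \<in> {0..1::real}" and C: "(\<zeta>, k) \<in> ?C"
    have "min \<zeta> c = \<beta> * min \<zeta> c + (1 - \<beta>) * min \<zeta> c" by (simp add: algebra_simps)
    also have "\<dots> \<le> \<beta> * \<zeta> + (1 - \<beta>) * c"
      using \<beta> by (intro add_mono mult_left_mono) auto
    finally have "ereal (w \<bullet> k + min \<zeta> c) \<le> ereal ((\<beta>, w) \<bullet> (\<zeta>, k)) + ereal (1 - \<beta>) * ereal c"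
      by simp
    also have "\<dots> \<le> Upsilon M S X \<beta> w + ereal (1 - \<beta>) * ereal c"
      unfolding Upsilon_eq_support by (intro add_right_mono SUP_upper C)
    finally show "ereal (w \<bullet> k + min \<zeta> c) \<le> Upsilon M S X \<beta> w + ereal (1 - \<beta>) * ereal c" .
  qed
  show "?L \<le> ?R"
  proof (rule ereal_le_real)
    fix m assume m: "?R \<le> ereal m"
    \<comment> \<open>The two coordinates are the values of the affine objective at \<open>\<beta> = 0\<close> and \<open>\<beta> = 1\<close>.\<close>
    let ?f = "\<lambda>(\<zeta>, k). (w \<bullet> k + c, w \<bullet> k + \<zeta>)"
    have "convex (?f ` ?C)"
    proof -
      have "?f = (\<lambda>z. (c, 0) + (w \<bullet> snd z, w \<bullet> snd z + fst z))" by (auto simp: fun_eq_iff)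
      then have "?f ` ?C = (+) (c, 0) ` (\<lambda>z. (w \<bullet> snd z, w \<bullet> snd z + fst z)) ` ?C"
        by (simp add: image_image)
      moreover have "linear (\<lambda>z::real \<times> (real ^ 'n). (w \<bullet> snd z, w \<bullet> snd z + fst z))"
        by (rule linearI) (auto simp: inner_add_right algebra_simps)
      ultimately show ?thesis
        by (simp only: convex_translation convex_linear_image convex_exp_sublevel measurable_SX)
    qed
    moreover have "?f ` ?C \<noteq> {}" using zero_mem_moment_set by auto
    moreover have "min a b \<le> m" if ab: "(a, b) \<in> ?f ` ?C" for a b
    proof -
      obtain \<zeta> k where C: "(\<zeta>, k) \<in> ?C" and "a = w \<bullet> k + c" "b = w \<bullet> k + \<zeta>" using ab by auto
      then have "min a b = w \<bullet> k + min \<zeta> c" by simp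
      moreover have "ereal (w \<bullet> k + min \<zeta> c) \<le> ereal m" using m C by (force simp: SUP_le_iff)
      ultimately show ?thesis by simp
    qed
    ultimately have "\<exists>\<beta>\<in>{0..1}. \<forall>a b. (a, b) \<in> ?f ` ?C \<longrightarrow> (1 - \<beta>) * a + \<beta> * b \<le> m"
      by (rule convex_plane_minimax)
    then obtain \<beta> where \<beta>: "\<beta> \<in> {0..1}"
      and le: "\<And>a b. (a, b) \<in> ?f ` ?C \<Longrightarrow> (1 - \<beta>) * a + \<beta> * b \<le> m" by blast
    have "Upsilon M S X \<beta> w \<le> ereal (m - (1 - \<beta>) * c)"
      unfolding Upsilon_eq_support
    proof (rule SUP_least, clarify)
      fix \<zeta> k assume "(\<zeta>, k) \<in> ?C"
      then have "(1 - \<beta>) * (w \<bullet> k + c) + \<beta> * (w \<bullet> k + \<zeta>) \<le> m" by (intro le) force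
      then show "ereal ((\<beta>, w) \<bullet> (\<zeta>, k)) \<le> ereal (m - (1 - \<beta>) * c)" by (simp add: algebra_simps)
    qed
    then have "Upsilon M S X \<beta> w + ereal (1 - \<beta>) * ereal c
        \<le> ereal (m - (1 - \<beta>) * c) + ereal (1 - \<beta>) * ereal c"
      by (rule add_right_mono)
    then have "Upsilon M S X \<beta> w + ereal (1 - \<beta>) * ereal c \<le> ereal m" by simp
    then show "?L \<le> ereal m" by (rule INF_lower2[OF \<beta>])
  qed
qed

lemma rate_I_eq:
  assumes "0 \<le> l"
  shows "rate_I M S X l w = (SUP k. ereal (w \<bullet> k) + min (phi M S X k) l)"
proof (cases l)
  case (real c)
  have "rate_I M S X l w = (SUP (\<zeta>, k)\<in>moment_set M S X. ereal (w \<bullet> k + min \<zeta> c))"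
    by (simp only: rate_I_def real INF_Upsilon_eq) simp
  also have "\<dots> = (SUP (\<zeta>, k)\<in>moment_set M S X. ereal (w \<bullet> k) + min (ereal \<zeta>) l)"
    by (simp add: real min_def case_prod_unfold if_distrib)
  finally show ?thesis by (simp only: SUP_phi_eq)
next
  case PInf
  have "rate_I M S X l w = (SUP p\<in>moment_set M S X. ereal ((1, w) \<bullet> p))"
    by (simp add: rate_I_def PInf Upsilon_eq_support)
  also have "\<dots> = (SUP (\<zeta>, k)\<in>moment_set M S X. ereal (w \<bullet> k) + min (ereal \<zeta>) l)"
    by (intro SUP_cong) (auto simp: PInf add.commute)
  finally show ?thesis by (simp only: SUP_phi_eq)
qed (use assms in simp)

end

theorem proposition2p1:
  fixes M :: "'a measure" and S :: "'a \<Rightarrow> real" and X :: "'a \<Rightarrow> real ^ 'n" and l :: ereal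
  assumes "prob_space M"
    and "S \<in> borel_measurable M" and "X \<in> borel_measurable M"
    and "\<And>\<omega>. \<omega> \<in> space M \<Longrightarrow> 0 \<le> S \<omega>"
    and "measure M {\<omega> \<in> space M. S \<omega> = 0} < 1"
    and "0 \<le> l"
    and "((\<lambda>s::real. - (ereal (1 / s) * ln_ennreal (emeasure M {\<omega> \<in> space M. s < S \<omega>})))
            \<longlongrightarrow> l) at_top"
  shows "upper_semicontinuous (phi M S X) \<and> ereal_concave (phi M S X) \<and>
    (\<forall>w. rate_I M S X l w = (SUP k. ereal (w \<bullet> k) + min (phi M S X k) l))"
proof -
  interpret reward_process M S X
    using assms by (intro reward_process.intro reward_process_axioms.intro) auto
  show ?thesis
    using upper_semicontinuous_phi ereal_concave_phi rate_I_eq[OF assms(6)] by blast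
qed

end
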